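(* Let $\Sigma_1=(G_1,\sigma_1)$ and $\Sigma_2=(G_2,\sigma_2)$ be two finite, simple, connected signed graphs, where $\Sigma_2$ is all-positive. Then the BCD-lexicographic product satisfies $\operatorname{bdim}(\Sigma_1*\Sigma_2)=\operatorname{bdim}(\Sigma_1)$.
   Context: A signed graph $\Sigma=(G,\sigma)$ is a graph $G=(V,E)$ with a function $\sigma:E\to\{+1,-1\}$; it is all-positive if every edge has sign $+1$. All graphs are finite, simple, connected and undirected unless otherwise mentioned. Let $\Omega=\{-1,0,1\}$, with $\Omega^k\subset\mathbb{R}^k$ carrying the standard inner product $\langle\cdot,\cdot\rangle$. A vector valued switching function ($k$-switching function) for $\Sigma$ is a map $\zeta:V\to\Omega^k$ with $\langle\zeta(u),\zeta(v)\rangle\neq 0$ for every edge $uv\in E$; the switched signed graph $\Sigma^\zeta=(G,\sigma^\zeta)$ has $\sigma^\zeta(uv)=\sigma(uv)\operatorname{sgn}(\langle\zeta(u),\zeta(v)\rangle)$. The balancing dimension $\operatorname{bdim}(\Sigma)$ is the least integer $k\ge 1$ for which there is a $k$-switching function $\zeta:V\to\Omega^k$ such that $\Sigma^\zeta$ is all-positive. The lexicographic product of graphs $G_1,G_2$ has vertex set $V(G_1)\times V(G_2)$, with $(u_i,v_j)$ adjacent to $(u_k,v_l)$ iff $u_i\sim u_k$ in $G_1$, or $u_i=u_k$ and $v_j\sim v_l$ in $G_2$. The BCD-lexicographic product $\Sigma_1*\Sigma_2$ is the signed graph on this lexicographic product with signature $$\sigma((u_i,v_j)(u_k,v_l))=\begin{cases}\sigma_1(u_iu_k)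 & \text{if } u_i\sim u_k \text{ and } v_j\nsim v_l,\\ \sigma_1(u_iu_k)\sigma_2(v_jv_l) & \text{if } u_i\sim u_k\text{ and } v_j\sim v_l,\\ \sigma_2(v_jv_l) & \text{if } u_i=u_k \text{ and } v_j\sim v_l,\end{cases}$$ where $v_j\nsim v_l$ includes the case $v_j=v_l$. *)

theory Defs
  imports "Graph_Theory.Graph_Theory" "Jordan_Normal_Form.Matrix"
begin

text \<open>
  An undirected simple graph is a symmetric loop-free digraph without parallel arcs
  (locale \<^locale>\<open>pair_graph\<close>, which includes finiteness); an edge \<open>uv\<close> is the pair of arcs
  \<open>(u, v)\<close> and \<open>(v, u)\<close>. The signature is accordingly a symmetric function of two vertices; its
  values on non-adjacent pairs are irrelevant.
\<close>

record 'a signed_graph =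
  ugraph :: "'a pair_pre_digraph"
  sig :: "'a \<Rightarrow> 'a \<Rightarrow> real"

definition verts_of :: "'a signed_graph \<Rightarrow> 'a set" where
  "verts_of S = pverts (ugraph S)"

definition adj :: "'a signed_graph \<Rightarrow> 'a \<Rightarrow> 'a \<Rightarrow> bool" where
  "adj S u v \<longleftrightarrow> (u, v) \<in> parcs (ugraph S)"

definition is_signed_graph :: "'a signed_graph \<Rightarrow> bool" where
  "is_signed_graph S \<longleftrightarrow> pair_graph (ugraph S) \<and>
     (\<forall>u v. adj S u v \<longrightarrow> sig S u v \<in> {1, -1} \<and> sig S u v = sig S v u)"

text \<open>The library's notion of connectedness requires a nonempty vertex set.\<close>

definition connected_sg :: "'a signed_graph \<Rightarrow> bool" where
  "connected_sg S \<longleftrightarrow> Digraph_Component.connected (with_proj (ugraph S))"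

definition all_positive :: "'a signed_graph \<Rightarrow> bool" where
  "all_positive S \<longleftrightarrow> (\<forall>u v. adj S u v \<longrightarrow> sig S u v = 1)"

definition Omega_vec :: "nat \<Rightarrow> real vec set" where
  "Omega_vec k = {x \<in> carrier_vec k. \<forall>i<k. x $ i \<in> {-1, 0, 1}}"

definition switching_function :: "nat \<Rightarrow> 'a signed_graph \<Rightarrow> ('a \<Rightarrow> real vec) \<Rightarrow> bool" where
  "switching_function k S \<zeta> \<longleftrightarrow>
     (\<forall>v\<in>verts_of S. \<zeta> v \<in> Omega_vec k) \<and> (\<forall>u v. adj S u v \<longrightarrow> \<zeta> u \<bullet> \<zeta> v \<noteq> 0)"

definition switch :: "'a signed_graph \<Rightarrow> ('a \<Rightarrow> real vec) \<Rightarrow> 'a signed_graph" where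
  "switch S \<zeta> = \<lparr>ugraph = ugraph S, sig = (\<lambda>u v. sig S u v * sgn (\<zeta> u \<bullet> \<zeta> v))\<rparr>"

definition bdim :: "'a signed_graph \<Rightarrow> nat" where
  "bdim S = (LEAST k. k \<ge> 1 \<and> (\<exists>\<zeta>. switching_function k S \<zeta> \<and> all_positive (switch S \<zeta>)))"

definition lex_product ::
  "'a pair_pre_digraph \<Rightarrow> 'b pair_pre_digraph \<Rightarrow> ('a \<times> 'b) pair_pre_digraph" where
  "lex_product G H =
     \<lparr>pverts = pverts G \<times> pverts H,
      parcs = {((u, v), (u', v')).
        u \<in> pverts G \<and> u' \<in> pverts G \<and> v \<in> pverts H \<and> v' \<in> pverts H \<and>
        ((u, u') \<in> parcs G \<or> u = u' \<and> (v, v') \<in> parcs H)}\<rparr>"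

text \<open>
  On edges of the product, the last branch is exactly the case \<open>u = u'\<close> with \<open>v\<close> adjacent to \<open>v'\<close>,
  since \<open>S\<close> has no loops.
\<close>

definition BCD_lex_product ::
  "'a signed_graph \<Rightarrow> 'b signed_graph \<Rightarrow> ('a \<times> 'b) signed_graph" where
  "BCD_lex_product S T =
     \<lparr>ugraph = lex_product (ugraph S) (ugraph T),
      sig = (\<lambda>(u, v) (u', v').
        if adj S u u' then (if adj T v v' then sig S u u' * sig T v v' else sig S u u')
        else sig T v v')\<rparr>"

lemma adj_props:
  assumes "is_signed_graph S" "adj S u v"
  shows "u \<in> verts_of S" "v \<in> verts_of S" "adj S v u" "u \<noteq> v"
    "sig S u v \<in> {1, -1}" "sig S v u = sig S u v"
proof -
  interpret pair_graph "ugraph S" using assms(1) by (simp add: is_signed_graph_def)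
  from assms(2) have a: "(u, v) \<in> parcs (ugraph S)" by (simp add: adj_def)
  show "u \<in> verts_of S" "v \<in> verts_of S" 
    using in_arcsD1[OF a] in_arcsD2[OF a] by (auto simp: verts_of_def)
  have "sym (parcs (ugraph S))" using pair_sym_arcs by (simp add: symmetric_def)
  then show "adj S v u" using a by (auto simp: adj_def dest: symD)
  show "u \<noteq> v" using pair_no_loops[OF a] by simp
  show "sig S u v \<in> {1, -1}" "sig S v u = sig S u v"
    using assms unfolding is_signed_graph_def by metis+
qed

lemma is_signed_graph_switch:
  assumes "is_signed_graph S" "switching_function k S \<zeta>"
  shows "is_signed_graph (switch S \<zeta>)"
proof -
  have "sig S u v * sgn (\<zeta> u \<bullet> \<zeta> v) \<in> {1, -1} \<and>
      sig S u v * sgn (\<zeta> u \<bullet> \<zeta> v) = sig S v u * sgn (\<zeta> v \<bullet> \<zeta> u)" if a: "adj S u v" for u v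
  proof -
    note p = adj_props[OF assms(1) a]
    have "\<zeta> u \<in> carrier_vec k" "\<zeta> v \<in> carrier_vec k" "\<zeta> u \<bullet> \<zeta> v \<noteq> 0"
      using assms(2) p a by (auto simp: switching_function_def Omega_vec_def)
    moreover from this have "\<zeta> u \<bullet> \<zeta> v = \<zeta> v \<bullet> \<zeta> u" by (intro comm_scalar_prod)
    ultimately show ?thesis using p by (auto simp: sgn_real_def)
  qed
  then show ?thesis using assms(1)
    unfolding is_signed_graph_def by (auto simp: switch_def adj_def)
qed

lemma is_signed_graph_BCD_lex_product:
  assumes S: "is_signed_graph S" and T: "is_signed_graph T"
  shows "is_signed_graph (BCD_lex_product S T)"
proof -
  note pS = adj_props[OF S, unfolded adj_def verts_of_def]
  note pT = adj_props[OF T, unfolded adj_def verts_of_def]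
  interpret S: pair_graph "ugraph S" using S by (simp add: is_signed_graph_def)
  interpret T: pair_graph "ugraph T" using T by (simp add: is_signed_graph_def)
  let ?G = "lex_product (ugraph S) (ugraph T)"
  have fin: "finite (pverts ?G)"
    using S.pair_finite_verts T.pair_finite_verts by (simp add: lex_product_def)
  have sub: "parcs ?G \<subseteq> pverts ?G \<times> pverts ?G" by (auto simp: lex_product_def)
  have "finite (parcs ?G)" using finite_subset[OF sub] fin by simp
  moreover have "sym (parcs ?G)"
    using pS(3) pT(3) by (auto simp: lex_product_def sym_def)
  moreover have "fst e \<noteq> snd e" if "e \<in> parcs ?G" for e
    using that pS(4) pT(4) by (auto simp: lex_product_def)
  ultimately have "pair_graph ?G"
    using fin sub by unfold_locales (auto simp: symmetric_def)
  then show ?thesis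
    using pS(3,5,6) pT(3,5,6)
    by (fastforce simp: is_signed_graph_def BCD_lex_product_def adj_def lex_product_def)
qed

text \<open>The set over which the balancing dimension minimises is nonempty.\<close>

lemma bdim_attained:
  assumes S: "is_signed_graph S"
  shows "bdim S \<ge> 1 \<and> (\<exists>\<zeta>. switching_function (bdim S) S \<zeta> \<and> all_positive (switch S \<zeta>))"
proof -
  interpret pair_graph "ugraph S" using S by (simp add: is_signed_graph_def)
  define A where "A = parcs (ugraph S)"
  have finA: "finite A" using pair_finite_arcs by (simp add: A_def)
  obtain f where f: "bij_betw f {0..<card A} A" 
    using ex_bij_betw_nat_finite[OF finA] by blast
  define c where "c = (\<lambda>e w. if w = fst e then 1 else if w = snd e then sig S (fst e) (snd e) else 0)"
  define k where "k = Suc (card A)"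
  define \<zeta> where "\<zeta> = (\<lambda>w. vec k (\<lambda>i. if i < card A then c (f i) w else 0))"
  have cs: "c e w \<in> {-1, 0, 1}" if "e \<in> A" for e w
    using that adj_props(5)[OF S, of "fst e" "snd e"] by (auto simp: c_def A_def adj_def)
  have dom: "\<zeta> w \<in> Omega_vec k" for w
    using cs bij_betwE[OF f] by (auto simp: Omega_vec_def \<zeta>_def)
  have ip: "\<zeta> u \<bullet> \<zeta> v = 2 * sig S u v" if a: "adj S u v" for u v
  proof -
    note p = adj_props[OF S a]
    have "\<zeta> u \<bullet> \<zeta> v = (\<Sum>i\<in>{0..<k}. (if i < card A then c (f i) u else 0) * (if i < card A then c (f i) v else 0))"
      by (simp add: scalar_prod_def \<zeta>_def)
    also have "\<dots> = (\<Sum>i\<in>{0..<card A}. c (f i) u * c (f i) v)"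
      by (simp add: k_def)
    also have "\<dots> = (\<Sum>e\<in>A. c e u * c e v)"
      by (rule sum.reindex_bij_betw[OF f])
    also have "\<dots> = (\<Sum>e\<in>{(u, v), (v, u)}. c e u * c e v)"
      using a p finA by (intro sum.mono_neutral_right) (auto simp: A_def adj_def c_def)
    also have "\<dots> = 2 * sig S u v" using p by (auto simp: c_def)
    finally show ?thesis .
  qed
  have "switching_function k S \<zeta>"
    unfolding switching_function_def
  proof (intro conjI ballI allI impI)
    fix u v assume a: "adj S u v"
    show "\<zeta> u \<bullet> \<zeta> v \<noteq> 0" using ip[OF a] adj_props(5)[OF S a] by auto
  qed (rule dom)
  moreover have "all_positive (switch S \<zeta>)"
    unfolding all_positive_def
  proof (intro allI impI)
    fix u v assume "adj (switch S \<zeta>) u v"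
    then have a: "adj S u v" by (simp add: adj_def switch_def)
    show "sig (switch S \<zeta>) u v = 1"
      using ip[OF a] adj_props(5)[OF S a] by (auto simp: switch_def)
  qed
  ultimately have "k \<ge> 1 \<and> (\<exists>\<zeta>. switching_function k S \<zeta> \<and> all_positive (switch S \<zeta>))"
    by (auto simp: k_def)
  then show ?thesis unfolding bdim_def by (rule LeastI)
qed

end

theory Submission
  imports Defs
begin

text \<open>Lower bound: fixing a vertex \<open>v\<close> of \<open>S2\<close>, the slice of all
  pairs \<open>(u, v)\<close> is a signed copy of \<open>S1\<close> in the product, and switching
  functions restrict to it (\<open>bdim_le_bdim_BCD_lex_product\<close>). Upper bound: take an
  optimal \<open>\<zeta>\<close> for \<open>S1\<close> and give every \<open>(u, v)\<close> the
  vector \<open>\<zeta> u\<close> (\<open>bdim_BCD_lex_product_le\<close>). Since \<open>S2\<close>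
  is all-positive, an edge of the product over an edge of \<open>S1\<close> keeps the sign of that
  edge, which \<open>\<zeta>\<close> already corrects. An edge inside a fibre is positive and sees
  the inner product of \<open>\<zeta> u\<close> with itself, which is positive once
  \<open>\<zeta> u\<close> is nonzero; \<open>nonzero_switching_function\<close> arranges this at
  every vertex.\<close>

lemma bdim_le:
  assumes "k \<ge> 1" "switching_function k S \<zeta>" "all_positive (switch S \<zeta>)"
  shows "bdim S \<le> k"
  unfolding bdim_def using assms by (intro Least_le) blast

text \<open>An optimal switching function of \<open>T\<close>, pulled back along \<open>f\<close>,
  meets the same inner products and the same signs on the edges of \<open>S\<close>.\<close>

lemma bdim_le_of_embedding:
  assumes T: "is_signed_graph T"
    and verts: "\<And>v. v \<in> verts_of S \<Longrightarrow> f v \<in> verts_of T"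
    and adj: "\<And>u v. adj S u v \<Longrightarrow> adj T (f u) (f v)"
    and sig: "\<And>u v. adj S u v \<Longrightarrow> sig T (f u) (f v) = sig S u v"
  shows "bdim S \<le> bdim T"
proof -
  obtain \<zeta> where \<zeta>: "bdim T \<ge> 1" "switching_function (bdim T) T \<zeta>" "all_positive (switch T \<zeta>)"
    using bdim_attained[OF T] by blast
  have pos: "sig T (f u) (f v) * sgn (\<zeta> (f u) \<bullet> \<zeta> (f v)) = 1" if "adj S u v" for u v
    using \<zeta>(3) adj[OF that] by (simp add: all_positive_def switch_def adj_def)
  show ?thesis
  proof (rule bdim_le[OF \<zeta>(1)])
    show "switching_function (bdim T) S (\<zeta> \<circ> f)"
      using \<zeta>(2) verts adj by (simp add: switching_function_def)
    show "all_positive (switch S (\<zeta> \<circ> f))"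
      using pos sig by (simp add: all_positive_def switch_def adj_def)
  qed
qed

lemma scalar_prod_self_pos:
  fixes x :: "real vec"
  assumes "x \<in> carrier_vec k" "x \<noteq> 0\<^sub>v k"
  shows "x \<bullet> x > 0"
proof -
  obtain i where i: "i < k" "x $ i \<noteq> 0" using assms by (auto simp: vec_eq_iff)
  then have "0 < (\<Sum>i\<in>{0..<k}. x $ i * x $ i)"
    by (intro sum_pos2[of _ i]) (auto simp: zero_less_mult_iff linorder_neq_iff)
  then show ?thesis using assms(1) by (simp add: scalar_prod_def)
qed

text \<open>Edges already force nonzero values at their endpoints, so only isolated vertices change.\<close>

lemma nonzero_switching_function:
  assumes S: "is_signed_graph S"
  obtains \<zeta> where "switching_function (bdim S) S \<zeta>" "all_positive (switch S \<zeta>)"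
    "\<And>v. v \<in> verts_of S \<Longrightarrow> \<zeta> v \<bullet> \<zeta> v > 0"
proof -
  define k where "k = bdim S"
  obtain \<zeta>\<^sub>0 where \<zeta>\<^sub>0: "k \<ge> 1" "switching_function k S \<zeta>\<^sub>0" "all_positive (switch S \<zeta>\<^sub>0)"
    using bdim_attained[OF S] by (auto simp: k_def)
  \<comment> \<open>A nonzero replacement value in \<open>Omega_vec k\<close>; it is nonzero because
    \<open>k\<close> is at least 1.\<close>
  define one :: "real vec" where "one = vec k (\<lambda>_. 1)"
  define \<zeta> where "\<zeta> v = (if \<zeta>\<^sub>0 v = 0\<^sub>v k then one else \<zeta>\<^sub>0 v)" for v
  have one: "one \<in> Omega_vec k" "one \<noteq> 0\<^sub>v k"
    using \<zeta>\<^sub>0(1) by (auto simp: one_def Omega_vec_def vec_eq_iff intro: exI[of _ 0])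
  have mem: "\<zeta>\<^sub>0 v \<in> Omega_vec k" "\<zeta> v \<in> Omega_vec k" if "v \<in> verts_of S" for v
    using \<zeta>\<^sub>0(2) one(1) that by (auto simp: switching_function_def \<zeta>_def)
  have eq: "\<zeta> u = \<zeta>\<^sub>0 u" "\<zeta> v = \<zeta>\<^sub>0 v" if a: "adj S u v" for u v
  proof -
    have "\<zeta>\<^sub>0 u \<in> carrier_vec k" "\<zeta>\<^sub>0 v \<in> carrier_vec k"
      using mem(1) adj_props(1,2)[OF S a] by (auto simp: Omega_vec_def)
    moreover have "\<zeta>\<^sub>0 u \<bullet> \<zeta>\<^sub>0 v \<noteq> 0" using \<zeta>\<^sub>0(2) a by (simp add: switching_function_def)
    ultimately show "\<zeta> u = \<zeta>\<^sub>0 u" "\<zeta> v = \<zeta>\<^sub>0 v" by (auto simp: \<zeta>_def)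
  qed
  show thesis
  proof (rule that)
    show "switching_function (bdim S) S \<zeta>"
      using \<zeta>\<^sub>0(2) mem(2) eq by (simp add: switching_function_def k_def)
    show "all_positive (switch S \<zeta>)"
      using \<zeta>\<^sub>0(3) eq by (simp add: all_positive_def switch_def adj_def)
    show "\<zeta> v \<bullet> \<zeta> v > 0" if "v \<in> verts_of S" for v
      using mem(2)[OF that] one(2)
      by (intro scalar_prod_self_pos[of _ k]) (auto simp: \<zeta>_def Omega_vec_def)
  qed
qed

lemma verts_of_BCD_lex_product:
  "verts_of (BCD_lex_product S T) = verts_of S \<times> verts_of T"
  by (simp add: verts_of_def BCD_lex_product_def lex_product_def)

lemma adj_BCD_lex_product:
  "adj (BCD_lex_product S T) (u, v) (u', v') \<longleftrightarrow>
     u \<in> verts_of S \<and> u' \<in> verts_of S \<and> v \<in> verts_of T \<and> v' \<in> verts_of T \<and>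
     (adj S u u' \<or> u = u' \<and> adj T v v')"
  by (simp add: adj_def verts_of_def BCD_lex_product_def lex_product_def)

lemma sig_BCD_lex_product:
  "sig (BCD_lex_product S T) (u, v) (u', v') =
     (if adj S u u' then if adj T v v' then sig S u u' * sig T v v' else sig S u u'
      else sig T v v')"
  by (simp add: BCD_lex_product_def)

lemma bdim_le_bdim_BCD_lex_product:
  assumes S: "is_signed_graph S" and T: "is_signed_graph T" and v: "v \<in> verts_of T"
  shows "bdim S \<le> bdim (BCD_lex_product S T)"
proof (rule bdim_le_of_embedding[where f = "\<lambda>u. (u, v)"])
  \<comment> \<open>Without a loop at \<open>v\<close>, edges within the slice fall in the branch of
    the signature that copies \<open>sig S\<close>.\<close>
  have "\<not> adj T v v" using adj_props(4)[OF T] by blast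
  then show "sig (BCD_lex_product S T) (u, v) (u', v) = sig S u u'" if "adj S u u'" for u u'
    using that by (simp add: sig_BCD_lex_product)
qed (use v adj_props(1,2)[OF S] is_signed_graph_BCD_lex_product[OF S T] in
    \<open>auto simp: verts_of_BCD_lex_product adj_BCD_lex_product\<close>)

text \<open>The witness is \<open>\<zeta> \<circ> fst\<close>, constant on each fibre.\<close>

lemma bdim_BCD_lex_product_le:
  assumes S: "is_signed_graph S" and pos: "all_positive T"
  shows "bdim (BCD_lex_product S T) \<le> bdim S"
proof -
  let ?P = "BCD_lex_product S T"
  obtain \<zeta> where \<zeta>: "switching_function (bdim S) S \<zeta>" "all_positive (switch S \<zeta>)"
    and self: "\<And>v. v \<in> verts_of S \<Longrightarrow> \<zeta> v \<bullet> \<zeta> v > 0"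
    using nonzero_switching_function[OF S] by blast
  have \<zeta>_pos: "sig S u u' * sgn (\<zeta> u \<bullet> \<zeta> u') = 1" if "adj S u u'" for u u'
    using \<zeta>(2) that by (simp add: all_positive_def switch_def adj_def)
  have P_pos: "sig ?P p q * sgn (\<zeta> (fst p) \<bullet> \<zeta> (fst q)) = 1" if "adj ?P p q" for p q
  proof (cases "adj S (fst p) (fst q)")
    \<comment> \<open>Both branches of the signature give \<open>sig S\<close>, as the factor from
      \<open>T\<close> is 1.\<close>
    case True
    then show ?thesis
      using \<zeta>_pos[OF True] pos
      by (cases p; cases q) (simp add: sig_BCD_lex_product all_positive_def)
  next
    \<comment> \<open>The edge lies in one fibre: the first coordinates agree, so the inner product
      is a positive square norm.\<close>
    case False
    then show ?thesis
      using that self pos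
      by (cases p; cases q) (auto simp: adj_BCD_lex_product sig_BCD_lex_product all_positive_def)
  qed
  show ?thesis
  proof (rule bdim_le)
    show "bdim S \<ge> 1" using bdim_attained[OF S] by blast
    show "switching_function (bdim S) ?P (\<zeta> \<circ> fst)"
      \<comment> \<open>Inner products on edges do not vanish, since \<open>sgn 0 = 0\<close> would
        contradict \<open>P_pos\<close>.\<close>
      using \<zeta>(1) P_pos by (force simp: switching_function_def verts_of_BCD_lex_product)
    show "all_positive (switch ?P (\<zeta> \<circ> fst))"
      using P_pos by (simp add: all_positive_def switch_def adj_def)
  qed
qed

theorem theorem2p23:
  fixes S1 :: "'a signed_graph" and S2 :: "'b signed_graph"
  assumes "is_signed_graph S1" and "connected_sg S1"
    and "is_signed_graph S2" and "connected_sg S2"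
    and "all_positive S2"
  shows "bdim (BCD_lex_product S1 S2) = bdim S1"
proof (rule antisym)
  \<comment> \<open>Connectedness includes having at least one vertex, which provides the
    slice.\<close>
  obtain v where "v \<in> verts_of S2"
    using assms(4)
    by (auto simp: connected_sg_def connected_def strongly_connected_def verts_of_def)
  then show "bdim S1 \<le> bdim (BCD_lex_product S1 S2)"
    by (rule bdim_le_bdim_BCD_lex_product[OF assms(1,3)])
  show "bdim (BCD_lex_product S1 S2) \<le> bdim S1"
    by (rule bdim_BCD_lex_product_le[OF assms(1,5)])
qed

end
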